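(* Let $\nabla$ be a non-metric cl-connection on $\mathbb{R}^2$ determined by $(W,m,n)$, where $W=(\cos\theta_{0},\sin\theta_{0})$ for any $\theta_0\in\mathbb{R}$. Let $c\in\mathbb{R}\setminus\{0\}$ be a prescribed constant. If $\gamma:I\to\mathbb{R}^2$ is a smooth curve parametrized by arc length with constant tangential curvature $\kappa_t=c$ with respect to $\nabla$, then up to translations $\gamma$ is uniquely given, for a suitable choice of the signs, by $$\gamma(s)=R_{\theta_{0}}\left(\pm\int^{s}\frac{c}{m+n}\,dt,\ \pm\int^{s}\sqrt{1-\frac{c^2}{(m+n)^2}}\,dt\right),$$ where $m,n$ are evaluated along $\gamma$ and $|m+n|\ge|c|$ along the trace of the curve. Furthermore, $\gamma$ is a straight line if and only if $m+n$ is constant along $\gamma$.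
   Context: $\langle\cdot,\cdot\rangle$ is the Euclidean metric on $\mathbb{R}^2$ and $\nabla^0$ its Levi-Civita connection. Let $W$ be a constant unit vector field on $\mathbb{R}^2$ and let $m,n:\mathbb{R}^2\to\mathbb{R}$ be smooth functions, not both identically zero. The canonical linear connection (cl-connection) determined by $(W,m,n)$ is $$\nabla_XY=\nabla^0_XY+m\langle W,Y\rangle X+n\langle X,Y\rangle W .$$ It is called non-metric if $m+n$ is nowhere zero on $\mathbb{R}^2$, i.e. $(m+n)(p)\neq 0$ for every $p$. For a smooth curve $\gamma$ parametrized by arc length with unit tangent $T=\gamma'$, the tangential curvature of $\gamma$ with respect to $\nabla$ is $\kappa_t=(m+n)\langle W,T\rangle$, where $m,n$ are evaluated along $\gamma$. $R_\theta$ denotes the rotation of $\mathbb{R}^2$ about the origin by the angle $\theta$. $\int^s$ denotes an antiderivative.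
   Formalization: The sign of the second integral is placed inside it as a function of the parameter, constant on each interval where |m+n|>|c|; one constant sign fails, e.g. for W=(1,0) on the arc (sin s, 1-cos s), |s|<1, with m+n=c/cos s along it. *)

theory Defs
  imports "HOL-Analysis.Analysis"
begin

text \<open>The iterated derivatives are taken within the set, so that the same notion serves for
  functions on the whole plane and for curves on a nondegenerate interval that may contain an
  end point; in both cases the derivative within the set is unique.\<close>

primrec C_k_on :: "nat \<Rightarrow> 'a::real_normed_vector set \<Rightarrow> ('a \<Rightarrow> 'b::real_normed_vector) \<Rightarrow> bool" where
  "C_k_on 0 S f \<longleftrightarrow> continuous_on S f"
| "C_k_on (Suc k) S f \<longleftrightarrow> f differentiable_on S \<and>
     (\<forall>v. C_k_on k S (\<lambda>x. frechet_derivative f (at x within S) v))"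

definition smooth_on :: "'a::real_normed_vector set \<Rightarrow> ('a \<Rightarrow> 'b::real_normed_vector) \<Rightarrow> bool" where
  "smooth_on S f \<longleftrightarrow> (\<forall>k. C_k_on k S f)"

type_synonym vector_field = "real^2 \<Rightarrow> real^2"

text \<open>The Levi-Civita connection of the Euclidean metric is the directional derivative.\<close>

definition levi_civita :: "vector_field \<Rightarrow> vector_field \<Rightarrow> vector_field" where
  "levi_civita X Y p = frechet_derivative Y (at p) (X p)"

definition cl_connection ::
  "(vector_field \<Rightarrow> vector_field \<Rightarrow> vector_field) \<Rightarrow> real^2 \<Rightarrow> (real^2 \<Rightarrow> real) \<Rightarrow> (real^2 \<Rightarrow> real) \<Rightarrow> bool"
  where
  "cl_connection D W m n \<longleftrightarrow>
     norm W = 1 \<and> smooth_on UNIV m \<and> smooth_on UNIV n \<and>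
     \<not> ((\<forall>p. m p = 0) \<and> (\<forall>p. n p = 0)) \<and>
     (\<forall>X Y. smooth_on UNIV X \<longrightarrow> smooth_on UNIV Y \<longrightarrow>
        (\<forall>p. D X Y p =
          levi_civita X Y p + (m p * (W \<bullet> Y p)) *\<^sub>R X p + (n p * (X p \<bullet> Y p)) *\<^sub>R W))"

definition non_metric :: "(real^2 \<Rightarrow> real) \<Rightarrow> (real^2 \<Rightarrow> real) \<Rightarrow> bool" where
  "non_metric m n \<longleftrightarrow> (\<forall>p. m p + n p \<noteq> 0)"

definition unit_tangent :: "real set \<Rightarrow> (real \<Rightarrow> real^2) \<Rightarrow> real \<Rightarrow> real^2" where
  "unit_tangent I \<gamma> s = vector_derivative \<gamma> (at s within I)"

definition arc_length_curve :: "real set \<Rightarrow> (real \<Rightarrow> real^2) \<Rightarrow> bool" where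
  "arc_length_curve I \<gamma> \<longleftrightarrow>
     is_interval I \<and> interior I \<noteq> {} \<and> smooth_on I \<gamma> \<and> (\<forall>s\<in>I. norm (unit_tangent I \<gamma> s) = 1)"

definition tangential_curvature ::
  "real^2 \<Rightarrow> (real^2 \<Rightarrow> real) \<Rightarrow> (real^2 \<Rightarrow> real) \<Rightarrow> real set \<Rightarrow> (real \<Rightarrow> real^2) \<Rightarrow> real \<Rightarrow> real" where
  "tangential_curvature W m n I \<gamma> s = (m (\<gamma> s) + n (\<gamma> s)) * (W \<bullet> unit_tangent I \<gamma> s)"

text \<open>The tangential curvature is the tangential component of \<open>\<nabla>\<^sub>T T\<close>.\<close>

lemma cl_connection_tangential_component:
  assumes "cl_connection D W m n" and "smooth_on UNIV X" and unit: "\<And>p. norm (X p) = 1"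
  shows "D X X p \<bullet> X p = (m p + n p) * (W \<bullet> X p)"
proof -
  have XX: "X q \<bullet> X q = 1" for q
    using unit[of q] by (simp add: dot_square_norm)
  have "C_k_on (Suc 0) UNIV X"
    using assms(2) unfolding smooth_on_def by blast
  then have "X differentiable (at p)"
    by (simp add: differentiable_on_def)
  then have X: "(X has_derivative frechet_derivative X (at p)) (at p)"
    by (simp add: frechet_derivative_works)
  have "((\<lambda>q. X q \<bullet> X q) has_derivative
      (\<lambda>h. X p \<bullet> frechet_derivative X (at p) h + frechet_derivative X (at p) h \<bullet> X p)) (at p)"
    by (rule has_derivative_inner[OF X X])
  moreover have "((\<lambda>q. X q \<bullet> X q) has_derivative (\<lambda>h. 0)) (at p)"
    by (simp add: XX)
  ultimately have "(\<lambda>h. X p \<bullet> frechet_derivative X (at p) h + frechet_derivative X (at p) h \<bullet> X p) = (\<lambda>h. 0)"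
    by (rule has_derivative_unique)
  then have "X p \<bullet> frechet_derivative X (at p) (X p) + frechet_derivative X (at p) (X p) \<bullet> X p = 0"
    by (rule fun_cong)
  then have "levi_civita X X p \<bullet> X p = 0"
    by (simp add: levi_civita_def inner_commute)
  moreover have "D X X p = levi_civita X X p + (m p * (W \<bullet> X p)) *\<^sub>R X p + (n p * (X p \<bullet> X p)) *\<^sub>R W"
    using assms unfolding cl_connection_def by blast
  ultimately show ?thesis
    by (simp add: XX inner_add_left algebra_simps)
qed

definition rotation2 :: "real \<Rightarrow> real^2^2" where
  "rotation2 \<theta> = vector [vector [cos \<theta>, - sin \<theta>], vector [sin \<theta>, cos \<theta>]]"

definition antiderivative_on :: "real set \<Rightarrow> (real \<Rightarrow> real) \<Rightarrow> (real \<Rightarrow> real) \<Rightarrow> bool" where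
  "antiderivative_on I F f \<longleftrightarrow> (\<forall>s\<in>I. (F has_real_derivative f s) (at s within I))"

text \<open>\<open>\<mu> s\<close> stands for the value of \<open>m + n\<close> at the parameter \<open>s\<close> of the curve. The first
  integrand has no zero, so its sign is a constant \<open>\<sigma>\<close>. The second integrand may vanish, namely
  where \<open>\<bar>\<mu> s\<bar> = \<bar>c\<bar>\<close>, and a smooth curve can pass from one sign to the other there (a circular
  arc through a point at which its tangent is \<open>W\<close>). The sign \<open>\<tau>\<close> is therefore a function
  under the integral, which may only change at such parameters.\<close>

definition sign_choice :: "real set \<Rightarrow> real \<Rightarrow> (real \<Rightarrow> real) \<Rightarrow> real \<Rightarrow> (real \<Rightarrow> real) \<Rightarrow> bool" where
  "sign_choice I c \<mu> \<sigma> \<tau> \<longleftrightarrow>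
     \<sigma> \<in> {1, -1} \<and> (\<forall>s\<in>I. \<tau> s \<in> {1, -1}) \<and>
     (\<forall>J\<subseteq>I. is_interval J \<and> (\<forall>s\<in>J. \<bar>\<mu> s\<bar> > \<bar>c\<bar>) \<longrightarrow> \<tau> constant_on J)"

definition given_by_integrals ::
  "real set \<Rightarrow> real \<Rightarrow> real \<Rightarrow> (real \<Rightarrow> real) \<Rightarrow> real \<Rightarrow> (real \<Rightarrow> real) \<Rightarrow> (real \<Rightarrow> real^2) \<Rightarrow> bool" where
  "given_by_integrals I \<theta> c \<mu> \<sigma> \<tau> \<gamma> \<longleftrightarrow>
     (\<exists>F G. antiderivative_on I F (\<lambda>t. c / \<mu> t) \<and>
            antiderivative_on I G (\<lambda>t. \<tau> t * sqrt (1 - c\<^sup>2 / (\<mu> t)\<^sup>2)) \<and>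
            (\<forall>s\<in>I. \<gamma> s = rotation2 \<theta> *v vector [\<sigma> * F s, G s]))"

end

theory Submission
  imports Defs
begin

text \<open>Write \<open>T\<close> for the unit tangent of \<open>\<gamma>\<close> and \<open>W\<^sup>\<bottom>\<close> for \<open>W\<close> turned by a right angle. The curvature
  equation \<open>\<mu> (W \<bullet> T) = c\<close> prescribes one coordinate of \<open>T\<close> in the orthonormal frame
  \<open>(W, W\<^sup>\<bottom>)\<close>, namely \<open>W \<bullet> T = c / \<mu>\<close>, and \<open>norm T = 1\<close> prescribes the other one up to a sign:
  \<open>(W\<^sup>\<bottom> \<bullet> T)\<^sup>2 = 1 - c\<^sup>2 / \<mu>\<^sup>2\<close>. In particular \<open>\<bar>c\<bar> \<le> \<bar>\<mu>\<bar>\<close>. Since \<open>R\<^bsub>\<theta>\<^sub>0\<^esub>\<close> takes the standard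
  frame to \<open>(W, W\<^sup>\<bottom>)\<close>, integrating the two coordinates gives the formula, where \<open>\<tau>\<close> is the sign
  of \<open>W\<^sup>\<bottom> \<bullet> T\<close>; antiderivatives on an interval differ by constants, which gives uniqueness up to
  translation.

  All statements about signs rest on one fact: a continuous real function on a connected set whose square
  is constant is itself constant (lemma \<open>constant_on_if_square_constant\<close>). It makes \<open>\<tau>\<close> constant
  on every interval where \<open>W\<^sup>\<bottom> \<bullet> T\<close> has no zero; it shows that the trace is collinear exactly if \<open>T\<close> is constant
  (lemma \<open>collinear_iff_unit_tangent_constant\<close>), since the only unit vectors along a line are two
  opposite ones; and it makes \<open>W\<^sup>\<bottom> \<bullet> T\<close>, hence \<open>T\<close>, constant as soon as \<open>\<mu>\<close> is.\<close>

section \<open>Constancy of signs\<close>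

lemma constant_on_if_square_constant:
  fixes f :: "'a::topological_space \<Rightarrow> real"
  assumes "connected S" and "continuous_on S f" and sq: "\<And>x. x \<in> S \<Longrightarrow> (f x)\<^sup>2 = k"
  shows "f constant_on S"
proof -
  have "f ` S \<subseteq> {sqrt k, - sqrt k}"
  proof
    fix y assume "y \<in> f ` S"
    then have "sqrt k = \<bar>y\<bar>"
      using sq by (auto simp flip: real_sqrt_abs)
    then show "y \<in> {sqrt k, - sqrt k}"
      by auto
  qed
  then have "finite (f ` S)"
    by (rule finite_subset) simp
  with assms(1,2) show ?thesis
    by (rule continuous_finite_range_constant)
qed

section \<open>The unit tangent\<close>

text \<open>An interval with interior points has no isolated points, so derivatives within it are
  unique.\<close>

lemma at_within_interval_neq_bot:
  fixes I :: "real set"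
  assumes "is_interval I" and "interior I \<noteq> {}" and "s \<in> I"
  shows "at s within I \<noteq> bot"
proof -
  have "I \<noteq> {x}" for x
    using assms(2) by auto
  then have "s islimpt I"
    by (rule connected_imp_perfect[OF is_interval_connected[OF assms(1)] assms(3)])
  then show ?thesis
    by (simp add: trivial_limit_within)
qed

text \<open>Smoothness speaks of the Frechet derivative, arc length of the vector derivative. The second
  claim identifies them, so that the continuity of the one passes to the other.\<close>

lemma
  assumes "arc_length_curve I \<gamma>" and "s \<in> I"
  shows arc_length_curve_has_vector_derivative:
      "(\<gamma> has_vector_derivative unit_tangent I \<gamma> s) (at s within I)"
    and unit_tangent_eq_frechet_derivative:
      "unit_tangent I \<gamma> s = frechet_derivative \<gamma> (at s within I) 1"
proof -
  have "C_k_on (Suc 0) I \<gamma>"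
    using assms(1) unfolding arc_length_curve_def smooth_on_def by blast
  then have diff: "\<gamma> differentiable (at s within I)"
    using assms(2) by (simp add: differentiable_on_def)
  then show T: "(\<gamma> has_vector_derivative unit_tangent I \<gamma> s) (at s within I)"
    unfolding unit_tangent_def by (simp flip: vector_derivative_works)
  have D: "(\<gamma> has_derivative frechet_derivative \<gamma> (at s within I)) (at s within I)"
    using diff by (simp flip: frechet_derivative_works)
  have "(\<lambda>h. h *\<^sub>R frechet_derivative \<gamma> (at s within I) 1) = frechet_derivative \<gamma> (at s within I)"
    by (simp add: fun_eq_iff flip: linear_scale[OF has_derivative_linear[OF D]])
  with D have "(\<gamma> has_vector_derivative frechet_derivative \<gamma> (at s within I) 1) (at s within I)"
    by (simp add: has_vector_derivative_def)
  moreover have "at s within I \<noteq> bot"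
    using assms unfolding arc_length_curve_def by (intro at_within_interval_neq_bot) simp_all
  ultimately show "unit_tangent I \<gamma> s = frechet_derivative \<gamma> (at s within I) 1"
    using T by (intro vector_derivative_unique_within)
qed

lemma continuous_on_unit_tangent:
  assumes "arc_length_curve I \<gamma>"
  shows "continuous_on I (unit_tangent I \<gamma>)"
proof -
  have "C_k_on (Suc 0) I \<gamma>"
    using assms unfolding arc_length_curve_def smooth_on_def by blast
  then have "continuous_on I (\<lambda>s. frechet_derivative \<gamma> (at s within I) 1)"
    by simp
  then show ?thesis
    using unit_tangent_eq_frechet_derivative[OF assms] by (simp cong: continuous_on_cong)
qed

lemma inner_has_real_derivative:
  assumes "(\<gamma> has_vector_derivative v) (at s within I)"
  shows "((\<lambda>s. w \<bullet> \<gamma> s) has_real_derivative w \<bullet> v) (at s within I)"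
  using bounded_linear.has_vector_derivative[OF bounded_linear_inner_right assms]
  by (simp add: has_real_derivative_iff_has_vector_derivative)

section \<open>Straight lines\<close>

text \<open>If the trace lies on a line with unit direction \<open>e\<close>, then the component of \<open>\<gamma>\<close> orthogonal to
  \<open>e\<close> is constant, so \<open>T = (T \<bullet> e) e\<close> and \<open>T \<bullet> e\<close> is a continuous function with square \<open>1\<close>: the
  curve cannot turn back. The converse is integration.\<close>

lemma collinear_iff_unit_tangent_constant:
  assumes curve: "arc_length_curve I \<gamma>"
  shows "collinear (\<gamma> ` I) \<longleftrightarrow> unit_tangent I \<gamma> constant_on I"
proof
  let ?T = "unit_tangent I \<gamma>"
  have I: "is_interval I" "interior I \<noteq> {}" and unit: "\<And>s. s \<in> I \<Longrightarrow> norm (?T s) = 1"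
    using curve by (auto simp: arc_length_curve_def)
  assume "collinear (\<gamma> ` I)"
  then obtain u where u: "\<And>s t. s \<in> I \<Longrightarrow> t \<in> I \<Longrightarrow> \<exists>k. \<gamma> s - \<gamma> t = k *\<^sub>R u"
    unfolding collinear_def by blast
  \<comment> \<open>A constant \<open>\<gamma>\<close> would allow \<open>u = 0\<close> and \<open>e = 0\<close>; then \<open>T = (e \<bullet> T) e\<close> below
    contradicts \<open>norm T = 1\<close>.\<close>
  define e where "e = sgn u"
  have T: "?T s = (e \<bullet> ?T s) *\<^sub>R e" if s: "s \<in> I" for s
  proof -
    have along: "\<gamma> t - \<gamma> s = (e \<bullet> \<gamma> t - e \<bullet> \<gamma> s) *\<^sub>R e" if t: "t \<in> I" for t
    proof -
      obtain k where k: "\<gamma> t - \<gamma> s = k *\<^sub>R u"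
        using u s t by blast
      have u_e: "u = norm u *\<^sub>R e" and "e \<bullet> u = norm u"
        by (cases "u = 0"; simp add: e_def sgn_div_norm dot_square_norm power2_eq_square)+
      then have "e \<bullet> \<gamma> t - e \<bullet> \<gamma> s = k * norm u"
        using k by (simp flip: inner_diff_right)
      then show ?thesis
        unfolding k by (subst u_e) simp
    qed
    have "((\<lambda>t. \<gamma> s + (e \<bullet> \<gamma> t - e \<bullet> \<gamma> s) *\<^sub>R e) has_vector_derivative (e \<bullet> ?T s) *\<^sub>R e)
        (at s within I)"
      using inner_has_real_derivative[OF arc_length_curve_has_vector_derivative[OF curve s], of e]
      by (auto intro!: derivative_eq_intros)
    then have "(\<gamma> has_vector_derivative (e \<bullet> ?T s) *\<^sub>R e) (at s within I)"
      by (rule has_vector_derivative_transform[OF s, rotated]) (simp flip: along)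
    with arc_length_curve_has_vector_derivative[OF curve s] show ?thesis
      using at_within_interval_neq_bot[OF I s] by (intro vector_derivative_unique_within)
  qed
  have "(e \<bullet> ?T s)\<^sup>2 = 1" if s: "s \<in> I" for s
  proof -
    have "\<bar>e \<bullet> ?T s\<bar> * norm e = 1"
      using unit[OF s] T[OF s] by (metis norm_scaleR)
    then have "\<bar>e \<bullet> ?T s\<bar> = 1"
      by (auto simp: e_def norm_sgn split: if_splits)
    then show ?thesis
      by (simp add: power2_eq_1_iff abs_if split: if_splits)
  qed
  then have "(\<lambda>s. e \<bullet> ?T s) constant_on I"
    using I(1) continuous_on_unit_tangent[OF curve]
    by (intro constant_on_if_square_constant is_interval_connected continuous_intros)
  then show "?T constant_on I"
    using T unfolding constant_on_def by metis
next
  have I: "is_interval I"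
    using curve by (simp add: arc_length_curve_def)
  assume "unit_tangent I \<gamma> constant_on I"
  then obtain v where v: "\<And>s. s \<in> I \<Longrightarrow> unit_tangent I \<gamma> s = v"
    unfolding constant_on_def by blast
  have "((\<lambda>s. \<gamma> s - s *\<^sub>R v) has_vector_derivative 0) (at s within I)"
    if "s \<in> I" for s
    using arc_length_curve_has_vector_derivative[OF curve that] v[OF that]
    by (auto intro!: derivative_eq_intros)
  from has_vector_derivative_zero_constant[OF is_interval_convex[OF I] this]
  obtain p where p: "\<And>s. s \<in> I \<Longrightarrow> \<gamma> s - s *\<^sub>R v = p"
    by blast
  have "\<gamma> s - \<gamma> t = (s - t) *\<^sub>R v" if "s \<in> I" "t \<in> I" for s t
    using p[OF that(1)] p[OF that(2)] by (simp add: algebra_simps)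
  then show "collinear (\<gamma> ` I)"
    unfolding collinear_def by blast
qed

section \<open>Curves given by integrals\<close>

lemma antiderivative_on_unique_up_to_constant:
  assumes "is_interval I" and "antiderivative_on I F f" and "antiderivative_on I G f"
  obtains k where "\<And>s. s \<in> I \<Longrightarrow> F s = G s + k"
proof -
  have "((\<lambda>s. F s - G s) has_real_derivative 0) (at s within I)" if "s \<in> I" for s
    using assms(2,3) that unfolding antiderivative_on_def by (auto intro!: derivative_eq_intros)
  then obtain k where "\<And>s. s \<in> I \<Longrightarrow> F s - G s = k"
    using has_field_derivative_zero_constant[OF is_interval_convex[OF assms(1)]] by metis
  then have "F s = G s + k" if "s \<in> I" for s
    using that by (simp add: diff_eq_eq add.commute)
  then show thesis
    by (rule that)
qed

lemma rotation2_vector: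
  "rotation2 \<theta> *v vector [x, y] =
     x *\<^sub>R vector [cos \<theta>, sin \<theta>] + y *\<^sub>R vector [- sin \<theta>, cos \<theta>]"
  by (simp add: vec_eq_iff forall_2 rotation2_def matrix_vector_mult_def sum_2 mult.commute)

lemma orthonormal_frame_expansion:
  "(vector [cos \<theta>, sin \<theta>] \<bullet> v) *\<^sub>R vector [cos \<theta>, sin \<theta>]
     + (vector [- sin \<theta>, cos \<theta>] \<bullet> v) *\<^sub>R vector [- sin \<theta>, cos \<theta>] = (v :: real^2)"
proof -
  have *: "cos \<theta> * cos \<theta> + sin \<theta> * sin \<theta> = 1"
    by simp
  show ?thesis
    by (simp add: vec_eq_iff forall_2 inner_vec_def sum_2) (intro conjI; use * in algebra)
qed

lemma orthonormal_frame_norm: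
  "(vector [cos \<theta>, sin \<theta>] \<bullet> v)\<^sup>2 + (vector [- sin \<theta>, cos \<theta>] \<bullet> v)\<^sup>2 = (norm (v :: real^2))\<^sup>2"
proof -
  have *: "cos \<theta> * cos \<theta> + sin \<theta> * sin \<theta> = 1"
    by simp
  show ?thesis
    by (simp add: power2_norm_eq_inner inner_vec_def sum_2) (use * in algebra)
qed

lemma given_by_integrals_unique_up_to_translation:
  assumes I: "is_interval I"
    and "given_by_integrals I \<theta> c \<mu> \<sigma> \<tau> \<gamma>" and "given_by_integrals I \<theta> c \<mu> \<sigma> \<tau> \<delta>"
  shows "\<exists>p. \<forall>s\<in>I. \<delta> s = \<gamma> s + p"
proof -
  obtain F G F' G' where
      F: "antiderivative_on I F (\<lambda>t. c / \<mu> t)" "antiderivative_on I F' (\<lambda>t. c / \<mu> t)"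
    and G: "antiderivative_on I G (\<lambda>t. \<tau> t * sqrt (1 - c\<^sup>2 / (\<mu> t)\<^sup>2))"
      "antiderivative_on I G' (\<lambda>t. \<tau> t * sqrt (1 - c\<^sup>2 / (\<mu> t)\<^sup>2))"
    and \<gamma>: "\<And>s. s \<in> I \<Longrightarrow> \<gamma> s = rotation2 \<theta> *v vector [\<sigma> * F s, G s]"
    and \<delta>: "\<And>s. s \<in> I \<Longrightarrow> \<delta> s = rotation2 \<theta> *v vector [\<sigma> * F' s, G' s]"
    using assms(2,3) unfolding given_by_integrals_def by blast
  obtain a where a: "\<And>s. s \<in> I \<Longrightarrow> F' s = F s + a"
    using antiderivative_on_unique_up_to_constant[OF I F(2,1)] by blast
  obtain b where b: "\<And>s. s \<in> I \<Longrightarrow> G' s = G s + b"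
    using antiderivative_on_unique_up_to_constant[OF I G(2,1)] by blast
  have "\<delta> s = \<gamma> s + rotation2 \<theta> *v vector [\<sigma> * a, b]" if "s \<in> I" for s
    by (simp add: that \<gamma> \<delta> a b rotation2_vector algebra_simps)
  then show ?thesis by blast
qed

section \<open>Curves of constant tangential curvature\<close>

theorem corollary3p3:
  fixes D :: "vector_field \<Rightarrow> vector_field \<Rightarrow> vector_field"
    and W :: "real^2" and m n :: "real^2 \<Rightarrow> real"
    and \<theta>\<^sub>0 c :: real and I :: "real set" and \<gamma> :: "real \<Rightarrow> real^2"
  assumes "cl_connection D W m n"
    and "non_metric m n"
    and "W = vector [cos \<theta>\<^sub>0, sin \<theta>\<^sub>0]"
    and "c \<noteq> 0"
    and "arc_length_curve I \<gamma>"
    and "\<forall>s\<in>I. tangential_curvature W m n I \<gamma> s = c"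
  defines "\<mu> \<equiv> \<lambda>s. m (\<gamma> s) + n (\<gamma> s)"
  shows "(\<forall>s\<in>I. \<bar>\<mu> s\<bar> \<ge> \<bar>c\<bar>) \<and>
    (\<exists>\<sigma> \<tau>. sign_choice I c \<mu> \<sigma> \<tau> \<and>
       given_by_integrals I \<theta>\<^sub>0 c \<mu> \<sigma> \<tau> \<gamma> \<and>
       (\<forall>\<delta>. given_by_integrals I \<theta>\<^sub>0 c \<mu> \<sigma> \<tau> \<delta> \<longrightarrow> (\<exists>p. \<forall>s\<in>I. \<delta> s = \<gamma> s + p))) \<and>
    (collinear (\<gamma> ` I) \<longleftrightarrow> \<mu> constant_on I)"
proof -
  let ?T = "unit_tangent I \<gamma>"
  define N :: "real^2" where "N = vector [- sin \<theta>\<^sub>0, cos \<theta>\<^sub>0]"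
  have W: "W = vector [cos \<theta>\<^sub>0, sin \<theta>\<^sub>0]" and c: "c \<noteq> 0" and curve: "arc_length_curve I \<gamma>"
    using assms by blast+
  then have I: "is_interval I" and unit: "\<And>s. s \<in> I \<Longrightarrow> norm (?T s) = 1"
    by (auto simp: arc_length_curve_def)
  have expand: "(W \<bullet> v) *\<^sub>R W + (N \<bullet> v) *\<^sub>R N = v" for v
    unfolding W N_def by (rule orthonormal_frame_expansion)
  have deriv: "((\<lambda>s. w \<bullet> \<gamma> s) has_real_derivative w \<bullet> ?T s) (at s within I)" if "s \<in> I" for w s
    using that by (intro inner_has_real_derivative arc_length_curve_has_vector_derivative curve)
  have cont: "continuous_on I (\<lambda>s. N \<bullet> ?T s)"
    by (intro continuous_intros continuous_on_unit_tangent curve)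

  have curvature: "\<mu> s * (W \<bullet> ?T s) = c" if "s \<in> I" for s
    using assms(6) that by (simp add: tangential_curvature_def \<mu>_def)
  have \<mu>: "\<mu> s \<noteq> 0" and WT: "W \<bullet> ?T s = c / \<mu> s" if "s \<in> I" for s
    using curvature[OF that] c by (auto simp: field_simps)
  have NT: "(N \<bullet> ?T s)\<^sup>2 = 1 - c\<^sup>2 / (\<mu> s)\<^sup>2" if "s \<in> I" for s
    using orthonormal_frame_norm[of \<theta>\<^sub>0 "?T s"] unit[OF that] WT[OF that]
    by (simp add: N_def power_divide flip: W)

  have bound: "\<bar>\<mu> s\<bar> \<ge> \<bar>c\<bar>" if "s \<in> I" for s
  proof -
    have "0 \<le> 1 - c\<^sup>2 / (\<mu> s)\<^sup>2"
      using NT[OF that] by (metis zero_le_power2)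
    then show ?thesis
      using \<mu>[OF that] by (simp add: field_simps flip: abs_le_square_iff)
  qed

  \<comment> \<open>The first sign can be \<open>1\<close>, because \<open>W \<bullet> T = c / \<mu>\<close> holds with its sign.\<close>
  define \<tau> :: "real \<Rightarrow> real" where "\<tau> s = (if N \<bullet> ?T s \<ge> 0 then 1 else - 1)" for s
  have sign: "sign_choice I c \<mu> 1 \<tau>"
    unfolding sign_choice_def
  proof (intro conjI ballI allI impI)
    fix J assume J: "J \<subseteq> I" "is_interval J \<and> (\<forall>s\<in>J. \<bar>\<mu> s\<bar> > \<bar>c\<bar>)"
    \<comment> \<open>Where \<open>\<bar>\<mu>\<bar> > \<bar>c\<bar>\<close>, the sign of \<open>N \<bullet> T\<close> is continuous.\<close>
    have nz: "N \<bullet> ?T s \<noteq> 0" if s: "s \<in> J" for s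
    proof
      assume "N \<bullet> ?T s = 0"
      then have "c\<^sup>2 = (\<mu> s)\<^sup>2"
        using NT[of s] \<mu>[of s] s J(1) by (auto simp: field_simps)
      then show False
        using J(2) s by (auto simp: power2_eq_iff)
    qed
    then have "continuous_on J (\<lambda>s. N \<bullet> ?T s / \<bar>N \<bullet> ?T s\<bar>)"
      using continuous_on_subset[OF cont J(1)] by (auto intro!: continuous_intros)
    moreover have "N \<bullet> ?T s / \<bar>N \<bullet> ?T s\<bar> = \<tau> s" if "s \<in> J" for s
      using nz[OF that] by (auto simp: \<tau>_def)
    ultimately have "continuous_on J \<tau>"
      by (simp cong: continuous_on_cong)
    then show "\<tau> constant_on J"
      using J(2) by (intro constant_on_if_square_constant[where k = 1] is_interval_connected)
        (auto simp: \<tau>_def)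
  qed (auto simp: \<tau>_def)

  have "N \<bullet> ?T s = \<tau> s * sqrt (1 - c\<^sup>2 / (\<mu> s)\<^sup>2)" if "s \<in> I" for s
    by (simp add: \<tau>_def flip: NT[OF that])
  then have integrals: "given_by_integrals I \<theta>\<^sub>0 c \<mu> 1 \<tau> \<gamma>"
    unfolding given_by_integrals_def antiderivative_on_def
    using deriv[of _ W] deriv[of _ N] WT expand
    by (intro exI[of _ "\<lambda>s. W \<bullet> \<gamma> s"] exI[of _ "\<lambda>s. N \<bullet> \<gamma> s"])
      (simp add: rotation2_vector flip: W N_def)

  have "?T constant_on I \<longleftrightarrow> \<mu> constant_on I"
  proof
    assume "?T constant_on I"
    then obtain v where "\<And>s. s \<in> I \<Longrightarrow> ?T s = v"
      unfolding constant_on_def by blast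
    then have "\<mu> s = c / (W \<bullet> v)" if "s \<in> I" for s
      using curvature[OF that] c that by (auto simp: field_simps)
    then show "\<mu> constant_on I"
      unfolding constant_on_def by blast
  next
    assume "\<mu> constant_on I"
    then obtain k where k: "\<And>s. s \<in> I \<Longrightarrow> \<mu> s = k"
      unfolding constant_on_def by blast
    have "(\<lambda>s. N \<bullet> ?T s) constant_on I"
      using I cont NT k
      by (intro constant_on_if_square_constant[where k = "1 - c\<^sup>2 / k\<^sup>2"] is_interval_connected) auto
    then obtain b where "\<And>s. s \<in> I \<Longrightarrow> N \<bullet> ?T s = b"
      unfolding constant_on_def by blast
    then have "?T s = (c / k) *\<^sub>R W + b *\<^sub>R N" if "s \<in> I" for s
      using expand[of "?T s"] WT[OF that] k[OF that] that by simp
    then show "?T constant_on I"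
      unfolding constant_on_def by blast
  qed
  then have "collinear (\<gamma> ` I) \<longleftrightarrow> \<mu> constant_on I"
    using collinear_iff_unit_tangent_constant[OF curve] by simp
  with bound sign integrals given_by_integrals_unique_up_to_translation[OF I integrals]
  show ?thesis by blast
qed

end
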